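(* For every $n\ge 1$, $$T_n(x)=\varphi(n)\Big(1-x^n+\sum_{d\mid n}\frac{\mu^2(d)}{\varphi(d)}\Psi_d\big(x^{n/d}\big)\Big),$$ where $T_n(x)=\sum_{k=0}^{n-1}|c_n(k)|x^k$ and $\Psi_d(x)=\sum_{1\le j\le d,\ \gcd(j,d)=1}x^j$.
   Context: For integers $n\ge 1$ and $k$, the Ramanujan sum $c_n(k)$ is the sum of the $k$th powers of the primitive $n$th roots of unity, i.e. $c_n(k)=\sum_{1\le j\le n,\ \gcd(j,n)=1} e^{2\pi \sqrt{-1}\, jk/n}$. $\varphi$ is Euler's function and $\mu$ the Möbius function. *)

theory Defs
  imports
    "HOL-Analysis.Analysis"
    "HOL-Number_Theory.Totient"
    "HOL-Computational_Algebra.Computational_Algebra"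
begin

definition ramanujan_sum :: "nat \<Rightarrow> int \<Rightarrow> complex" where
  "ramanujan_sum n k =
     (\<Sum>j\<in>{j\<in>{1..n}. coprime j n}. exp (2 * of_real pi * \<i> * of_nat j * of_int k / of_nat n))"

text \<open>The number-theoretic Moebius function; the constant \<open>moebius\<close> of
  HOL-Analysis denotes fractional linear transformations.\<close>

definition moebius_mu :: "nat \<Rightarrow> int" where
  "moebius_mu n = (if squarefree n then (- 1) ^ card (prime_factors n) else 0)"

definition T_poly :: "nat \<Rightarrow> real poly" where
  "T_poly n = (\<Sum>k<n. monom (cmod (ramanujan_sum n (int k))) k)"

definition Psi_poly :: "nat \<Rightarrow> real poly" where
  "Psi_poly d = (\<Sum>j\<in>{j\<in>{1..d}. coprime j d}. monom 1 j)"

end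

theory Submission
  imports Defs
begin

text \<open>
  The key point is Hoelder's evaluation \<open>c\<^sub>n(k) = \<mu>(d) \<phi>(n) / \<phi>(d)\<close> with \<open>d = n / gcd(n, k)\<close>. It
  is proved by removing one prime \<open>p\<close> from \<open>n = p m\<close>: the sum of \<open>e(j k / n)\<close> over all \<open>j \<le> n\<close>
  coprime to \<open>m\<close> splits into \<open>m\<close>-translates and equals \<open>p c\<^sub>m(k / p)\<close> or \<open>0\<close> according to whether
  \<open>p\<close> divides \<open>k\<close>. If \<open>p\<close> divides \<open>m\<close> this is \<open>c\<^sub>n(k)\<close> itself; otherwise the multiples of \<open>p\<close>
  contribute a further \<open>c\<^sub>m(k)\<close> that has to be subtracted. The theorem follows by sorting the
  exponents \<open>1 \<le> k \<le> n\<close> according to \<open>n / gcd(n, k)\<close>.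
\<close>

section \<open>Exponential sums over integers coprime to a divisor of the modulus\<close>

lemma ramanujan_sum_cis:
  "ramanujan_sum n (int k) =
     (\<Sum>j\<in>{j\<in>{1..n}. coprime j n}. cis (2 * pi * (real j * real k / real n)))"
  unfolding ramanujan_sum_def by (intro sum.cong refl) (simp add: cis_conv_exp mult_ac)

lemma cis_2pi_int: "cis (2 * pi * of_int k) = 1"
  using cis_multiple_2pi[of "of_int k"] by simp

text \<open>This is a geometric sum whose ratio \<open>w\<close> = e(k/p) satisfies
  \<open>w ^ p = 1\<close>, so it vanishes unless \<open>w\<close> itself is 1.\<close>

lemma sum_cis_roots_of_unity:
  assumes "p > 0"
  shows "(\<Sum>i<p. cis (2 * pi * (real i * real k / real p))) = (if p dvd k then of_nat p else 0)"
proof -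
  define w where "w = cis (2 * pi * (real k / real p))"
  have pow: "cis (2 * pi * (real i * real k / real p)) = w ^ i" for i
    unfolding w_def Complex.DeMoivre by (simp add: mult_ac)
  have wp: "w ^ p = 1"
    using cis_2pi_int[of "int k"] assms unfolding w_def Complex.DeMoivre by (simp add: mult_ac)
  have w1: "w = 1 \<longleftrightarrow> p dvd k"
  proof
    assume "w = 1"
    \<comment> \<open>The real part is enough: cosine takes the value 1 only at integer multiples of
      2 pi, so k/p is an integer.\<close>
    then have "cos (2 * pi * (real k / real p)) = 1"
      by (simp add: w_def complex_eq_iff)
    then obtain z :: int where "2 * pi * (real k / real p) = real_of_int z * 2 * pi"
      unfolding cos_one_2pi_int by auto
    then have "real k = real_of_int z * real p"
      using assms by (simp add: field_simps)
    then have "int k = z * int p"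
      by (metis of_int_eq_iff of_int_mult of_int_of_nat_eq)
    then show "p dvd k" by (metis dvd_triv_right int_dvd_int_iff)
  next
    assume "p dvd k"
    then obtain l where "k = p * l" by auto
    then show "w = 1"
      using cis_2pi_int[of "int l"] assms by (simp add: w_def)
  qed
  show ?thesis
  proof (cases "w = 1")
    case True
    then show ?thesis using w1 unfolding pow by simp
  next
    case False
    then show ?thesis using w1 wp unfolding pow by (simp add: geometric_sum)
  qed
qed

text \<open>Coprimality to \<open>m\<close> is periodic with period \<open>m\<close>, so the index
  set consists of \<open>p\<close> consecutive blocks, each a translate of the first.\<close>

lemma sum_coprime_blocks:
  fixes f :: "nat \<Rightarrow> 'a::comm_monoid_add"
  shows "(\<Sum>j\<in>{j\<in>{1..p * m}. coprime j m}. f j) =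
         (\<Sum>i<p. \<Sum>j\<in>{j\<in>{1..m}. coprime j m}. f (j + i * m))"
proof (induction p)
  case 0
  then show ?case by simp
next
  case (Suc p)
  let ?B = "{j\<in>{1..m}. coprime j m}"
  have cop: "coprime (j + i * m) m \<longleftrightarrow> coprime j m" for i j
    by (metis coprime_iff_gcd_eq_1 gcd.commute gcd_add_mult add.commute mult.commute)
  have split: "{j\<in>{1..Suc p * m}. coprime j m} =
      {j\<in>{1..p * m}. coprime j m} \<union> (\<lambda>j. j + p * m) ` ?B" (is "?L = ?R")
  proof (intro set_eqI iffI)
    fix x assume x: "x \<in> ?L"
    show "x \<in> ?R"
    proof (cases "x \<le> p * m")
      case False
      then have "x = (x - p * m) + p * m" by simp
      moreover have "x - p * m \<in> ?B"
        using x False cop[of "x - p * m" p] by auto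
      ultimately show ?thesis by blast
    qed (use x in auto)
  qed (auto simp: cop)
  have "sum f ?L = sum f {j\<in>{1..p * m}. coprime j m} + sum f ((\<lambda>j. j + p * m) ` ?B)"
    unfolding split by (rule sum.union_disjoint) auto
  also have "sum f ((\<lambda>j. j + p * m) ` ?B) = (\<Sum>j\<in>?B. f (j + p * m))"
    by (subst sum.reindex) (auto simp: inj_on_def)
  finally show ?case using Suc by simp
qed

text \<open>On the block shifted by i m the exponential factors as e(jk/(pm)) e(ik/p). The double
  sum is therefore a product, and its factor over i is a sum of powers of a \<open>p\<close>-th root
  of unity.\<close>

lemma sum_cis_coprime_multiple:
  assumes "p > 0" "m > 0"
  shows "(\<Sum>j\<in>{j\<in>{1..p * m}. coprime j m}. cis (2 * pi * (real j * real k / real (p * m)))) =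
         (if p dvd k then of_nat p * ramanujan_sum m (int (k div p)) else 0)"
proof -
  let ?B = "{j\<in>{1..m}. coprime j m}"
  have "cis (2 * pi * (real (j + i * m) * real k / real (p * m))) =
      cis (2 * pi * (real j * real k / real (p * m))) * cis (2 * pi * (real i * real k / real p))"
    for i j
    using assms by (simp add: cis_mult field_simps)
  then have "(\<Sum>j\<in>{j\<in>{1..p * m}. coprime j m}. cis (2 * pi * (real j * real k / real (p * m)))) =
      (\<Sum>i<p. \<Sum>j\<in>?B. cis (2 * pi * (real j * real k / real (p * m))) *
                      cis (2 * pi * (real i * real k / real p)))"
    by (simp only: sum_coprime_blocks)
  also have "\<dots> = (\<Sum>j\<in>?B. cis (2 * pi * (real j * real k / real (p * m)))) *
                  (\<Sum>i<p. cis (2 * pi * (real i * real k / real p)))"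
    by (subst sum.swap) (simp only: sum_product)
  also have "\<dots> = (if p dvd k then of_nat p * ramanujan_sum m (int (k div p)) else 0)"
  proof (cases "p dvd k")
    case True
    \<comment> \<open>With this \<open>l\<close>, e(jk/(pm)) = e(jl/m), so the remaining factor is
      c_m(l).\<close>
    then obtain l where "k = p * l" by auto
    then show ?thesis
      using assms by (simp add: sum_cis_roots_of_unity ramanujan_sum_cis)
  next
    case False
    then show ?thesis using sum_cis_roots_of_unity[OF assms(1), of k] by simp
  qed
  finally show ?thesis .
qed

lemma ramanujan_sum_prime_mult_dvd:
  assumes "prime p" "p dvd m" "m > 0"
  shows "ramanujan_sum (p * m) (int k) =
         (if p dvd k then of_nat p * ramanujan_sum m (int (k div p)) else 0)"
proof -
  have "coprime j (p * m) \<longleftrightarrow> coprime j m" for j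
    using assms by (metis coprime_mult_right_iff dvd_def)
  then show ?thesis
    using sum_cis_coprime_multiple[of p m k] assms prime_gt_0_nat
    by (simp add: ramanujan_sum_cis)
qed

text \<open>An index coprime to \<open>m\<close> is either coprime to \<open>p\<close> as well or of
  the form p y with y coprime to \<open>m\<close>. Since e(pyk/(pm)) = e(yk/m), the second kind sums
  to c_m(k).\<close>

lemma ramanujan_sum_prime_mult_not_dvd:
  assumes "prime p" "\<not> p dvd m" "m > 0"
  shows "ramanujan_sum (p * m) (int k) =
         (if p dvd k then of_nat p * ramanujan_sum m (int (k div p)) else 0) - ramanujan_sum m (int k)"
proof -
  let ?f = "\<lambda>j. cis (2 * pi * (real j * real k / real (p * m)))"
  have p0: "p > 0" using assms prime_gt_0_nat by blast
  have pm: "coprime p m" using assms prime_imp_coprime by blast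
  have split: "{j\<in>{1..p * m}. coprime j m} =
      {j\<in>{1..p * m}. coprime j (p * m)} \<union> (\<lambda>j. p * j) ` {j\<in>{1..m}. coprime j m}" (is "?L = ?A \<union> ?R")
  proof (intro set_eqI iffI)
    fix x assume x: "x \<in> ?L"
    show "x \<in> ?A \<union> ?R"
    proof (cases "p dvd x")
      case True
      then obtain y where "x = p * y" by auto
      then show ?thesis using x p0 by auto
    next
      case False
      then have "coprime x p"
        using assms(1) prime_imp_coprime coprime_commute by blast
      then show ?thesis using x by auto
    qed
  qed (use pm p0 in \<open>auto simp: Suc_le_eq\<close>)
  have "?A \<inter> ?R = {}"
    using assms(1) by auto
  then have "sum ?f ?L = sum ?f ?A + sum ?f ?R"
    unfolding split by (intro sum.union_disjoint) auto
  moreover have "sum ?f ?R = ramanujan_sum m (int k)"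
    unfolding ramanujan_sum_cis using p0 by (subst sum.reindex) (auto simp: inj_on_def mult.assoc)
  moreover have "sum ?f ?A = ramanujan_sum (p * m) (int k)"
    by (simp add: ramanujan_sum_cis)
  ultimately show ?thesis
    using sum_cis_coprime_multiple[OF p0 assms(3), of k] by (simp add: algebra_simps)
qed

section \<open>Hoelder's evaluation of the Ramanujan sum\<close>

lemma moebius_mu_prime_mult:
  assumes "prime p" "\<not> p dvd d"
  shows "moebius_mu (p * d) = - moebius_mu d"
proof (cases "d = 0")
  case False
  have cop: "coprime p d" using assms prime_imp_coprime by blast
  then have "squarefree (p * d) \<longleftrightarrow> squarefree d"
    using assms squarefree_mult_coprime squarefree_prime squarefree_multD(2) by blast
  moreover have "prime_factors (p * d) = insert p (prime_factors d)"
    using assms False by (subst prime_factors_product) (auto simp: prime_prime_factors)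
  moreover have "p \<notin> prime_factors d" using assms by auto
  ultimately show ?thesis by (simp add: moebius_mu_def)
qed (use assms in simp)

theorem ramanujan_sum_Hoelder:
  assumes "n > 0"
  defines "d \<equiv> (\<lambda>n k. n div gcd n k)"
  shows "ramanujan_sum n (int k) =
         of_int (moebius_mu (d n k)) * of_nat (totient n) / of_nat (totient (d n k))"
  using assms(1)
\<comment> \<open>\<open>k\<close> must vary, since the reduction from \<open>p * m\<close> to
  \<open>m\<close> may replace \<open>k\<close> by \<open>k div p\<close>.\<close>
proof (induction n arbitrary: k rule: less_induct)
  case (less n)
  show ?case
  proof (cases "n = 1")
    case True
    have "{j\<in>{1..1::nat}. coprime j 1} = {1}" by auto
    then show ?thesis
      using True cis_2pi_int[of "int k"] by (simp add: ramanujan_sum_cis moebius_mu_def d_def)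
  next
    case False
    then obtain p where p: "prime p" "p dvd n" using prime_factor_nat by blast
    then obtain m where n: "n = p * m" by auto
    have p0: "p > 1" using p prime_gt_1_nat by blast
    have m: "m > 0" "m < n" using n less.prems p0 by auto
    note IH = less.IH[OF m(2) m(1)]
    have dm: "d m k > 0" "d m k * gcd m k = m" for k
      using m by (auto simp: d_def div_greater_zero_iff gcd_le1_nat)
    have gdvd: "d n k = d m (k div p)" if "p dvd k"
      using that p0 n by (auto simp: d_def gcd_mult_distrib_nat[symmetric])
    \<comment> \<open>The extra factor \<open>p\<close> of \<open>n\<close> does not enter the gcd,
      so it survives in the quotient.\<close>
    have gnot: "d n k = p * d m k" if "\<not> p dvd k"
    proof -
      have "coprime p k" using that p prime_imp_coprime by blast
      then have "gcd n k = gcd m k"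
        by (simp add: n gcd_mult_left_left_cancel coprime_commute)
      then show ?thesis by (simp add: d_def n div_mult_swap)
    qed
    show ?thesis
    proof (cases "p dvd m")
      case True
      have tot: "totient n = p * totient m"
        using totient_gcd[of p m] True p0 n by (simp add: gcd_nat.absorb1)
      show ?thesis
      proof (cases "p dvd k")
        case True
        then show ?thesis
          using ramanujan_sum_prime_mult_dvd[OF p(1) \<open>p dvd m\<close> m(1), of k] IH tot gdvd n by simp
      next
        case False
        \<comment> \<open>Both sides vanish here: the sum because \<open>p\<close> does not divide
          \<open>k\<close>, the right-hand side because dividing \<open>m\<close> by a gcd prime to
          \<open>p\<close> keeps a factor \<open>p\<close>, and \<open>n\<close> supplies a second
          one.\<close>
        have "coprime p (gcd m k)"
          using False p(1) prime_imp_coprime by (meson dvd_trans gcd_dvd2)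
        then have "p dvd d m k"
          using True dm(2)[of k] by (metis coprime_dvd_mult_left_iff)
        then have "p\<^sup>2 dvd d n k"
          using gnot[OF False] by (simp add: power2_eq_square)
        then have "\<not> squarefree (d n k)"
          using p0 squarefreeD[of "d n k" p] by auto
        then show ?thesis
          using ramanujan_sum_prime_mult_dvd[OF p(1) \<open>p dvd m\<close> m(1), of k] False n
          by (simp add: moebius_mu_def)
      qed
    next
      case False
      have cop: "coprime p m" using False p prime_imp_coprime by blast
      have tot: "totient n = (p - 1) * totient m"
        using cop p by (simp add: n totient_mult_coprime totient_prime)
      show ?thesis
      proof (cases "p dvd k")
        case True
        then obtain l where k: "k = p * l" by auto
        \<comment> \<open>As \<open>p\<close> does not divide \<open>m\<close>, dividing
          \<open>k\<close> by \<open>p\<close> changes neither the gcd nor, by induction, the value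
          of c_m; the two terms of the difference then combine to (p - 1) c_m.\<close>
        have "gcd m k = gcd m l"
          using cop by (simp add: k gcd_mult_right_left_cancel coprime_commute)
        then have "ramanujan_sum m (int k) = ramanujan_sum m (int (k div p))"
          using p0 IH[of k] IH[of l] by (simp add: d_def k)
        then have "ramanujan_sum n (int k) = of_nat (p - 1) * ramanujan_sum m (int (k div p))"
          using ramanujan_sum_prime_mult_not_dvd[OF p(1) False m(1), of k] True p0
          by (simp add: n of_nat_diff algebra_simps)
        then show ?thesis
          by (simp add: IH gdvd[OF True] tot)
      next
        case nk: False
        \<comment> \<open>Passing from \<open>m\<close> to \<open>n\<close> multiplies both totients
          by p - 1, which cancels, and the new prime flips the sign of the Moebius value, matching
          the term -c_m(k).\<close>
        have nd: "\<not> p dvd d m k" using False dm(2)[of k] by (metis dvd_mult2)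
        have "totient (d n k) = (p - 1) * totient (d m k)"
          using p(1) gnot[OF nk] prime_imp_coprime[OF p(1) nd] by (simp add: totient_mult_coprime totient_prime)
        then show ?thesis
          using ramanujan_sum_prime_mult_not_dvd[OF p(1) False m(1), of k] nk p0
            moebius_mu_prime_mult[OF p(1) nd]
          by (simp add: IH tot n[symmetric] gnot)
      qed
    qed
  qed
qed

text \<open>Moebius values lie in {-1, 0, 1}, so the absolute value equals the square.\<close>

lemma norm_ramanujan_sum:
  assumes "n > 0"
  shows "cmod (ramanujan_sum n (int k)) = real (totient n) *
    (real_of_int ((moebius_mu (n div gcd n k))\<^sup>2) / real (totient (n div gcd n k)))"
proof -
  have "\<bar>moebius_mu d\<bar> = (moebius_mu d)\<^sup>2" for d
    by (simp add: moebius_mu_def power_abs flip: power_mult)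
  then show ?thesis
    by (simp add: ramanujan_sum_Hoelder[OF assms] norm_mult norm_divide flip: of_int_abs)
qed

section \<open>Regrouping the exponents by their gcd with n\<close>

lemma smult_sum_right: "smult c (sum f A) = (\<Sum>i\<in>A. smult c (f i))"
  by (rule poly_eqI) (simp add: coeff_sum sum_distrib_left)

lemma pcompose_Psi_poly:
  "pcompose (Psi_poly d) (monom 1 m) = (\<Sum>j\<in>{j\<in>{1..d}. coprime j d}. monom 1 (j * m))"
proof -
  \<comment> \<open>Real polynomials are determined by their values, so this reduces to a law of
    powers.\<close>
  have "pcompose (monom 1 j) (monom 1 m) = (monom 1 (j * m) :: real poly)" for j
    by (subst poly_eq_poly_eq_iff[symmetric])
      (simp add: fun_eq_iff poly_pcompose poly_monom mult.commute flip: power_mult)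
  then show ?thesis by (simp add: Psi_poly_def pcompose_sum)
qed

text \<open>Reducing k/n to lowest terms j/d is a bijection from the exponents \<open>k\<close> to
  the pairs (d, j), with inverse k = j (n/d).\<close>

lemma sum_divisors_coprime:
  fixes f :: "nat \<Rightarrow> nat \<Rightarrow> 'a::comm_monoid_add"
  assumes "n > 0"
  shows "(\<Sum>d | d dvd n. \<Sum>j\<in>{j\<in>{1..d}. coprime j d}. f d (j * (n div d))) =
         (\<Sum>k\<in>{1..n}. f (n div gcd n k) k)"
proof -
  have div_div: "n div (n div d) = d" if "d dvd n" for d
    using that assms by auto
  have gcd: "gcd n (j * (n div d)) = n div d" if "d dvd n" "coprime j d" for d j
  proof -
    have "gcd ((n div d) * d) ((n div d) * j) = n div d"
      unfolding gcd_mult_distrib_nat[symmetric] using that(2) by (simp add: coprime_iff_gcd_eq_1 gcd.commute)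
    then show ?thesis using that(1) by (simp add: mult.commute)
  qed
  have "(\<Sum>d | d dvd n. \<Sum>j\<in>{j\<in>{1..d}. coprime j d}. f d (j * (n div d))) =
      (\<Sum>(d, j)\<in>(SIGMA d:{d. d dvd n}. {j\<in>{1..d}. coprime j d}). f d (j * (n div d)))"
    using assms by (intro sum.Sigma) auto
  also have "\<dots> = (\<Sum>k\<in>{1..n}. f (n div gcd n k) k)"
  proof (rule sum.reindex_bij_witness[of _ "\<lambda>k. (n div gcd n k, k div gcd n k)"
        "\<lambda>(d, j). j * (n div d)"], goal_cases)
    case (1 a)
    obtain d j where a: "a = (d, j)" "d dvd n" "coprime j d" using 1 by auto
    then have "n div d > 0" using assms by auto
    then show ?case using a by (simp add: gcd div_div)
  next
    case (2 a)
    obtain d j where a: "a = (d, j)" "d dvd n" "j \<in> {1..d}" using 2 by auto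
    then have "0 < n div d" "j * (n div d) \<le> d * (n div d)" using assms by auto
    then show ?case using a by auto
  next
    case (3 k)
    then show ?case using div_div[of "gcd n k"] by simp
  next
    case (4 k)
    have "k div gcd n k \<le> n div gcd n k" using 4 by (simp add: div_le_mono)
    moreover have "k div gcd n k > 0"
      using 4 by (simp add: div_greater_zero_iff gcd_le2_nat)
    moreover have "coprime (k div gcd n k) (n div gcd n k)"
      using 4 by (metis assms coprime_commute div_gcd_coprime not_gr0)
    moreover have "n div gcd n k dvd n" by (metis dvd_div_mult_self dvd_triv_left gcd_dvd1)
    ultimately show ?case by simp
  next
    case (5 a)
    obtain d j where a: "a = (d, j)" "d dvd n" "coprime j d" using 5 by auto
    then show ?case by (simp add: gcd div_div)
  qed
  finally show ?thesis .
qed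

theorem theorem10:
  fixes n :: nat
  assumes "n \<ge> 1"
  shows "T_poly n =
    smult (real (totient n))
      (1 - monom 1 n +
        (\<Sum>d | d dvd n.
          smult (real_of_int ((moebius_mu d)\<^sup>2) / real (totient d))
            (pcompose (Psi_poly d) (monom 1 (n div d)))))"
proof -
  define w where "w d = real_of_int ((moebius_mu d)\<^sup>2) / real (totient d)" for d
  define g where "g k = smult (w (n div gcd n k)) (monom 1 k)" for k
  have n: "n > 0" using assms by simp
  have w1: "w 1 = 1" by (simp add: w_def moebius_mu_def)
  have "(\<Sum>d | d dvd n. smult (w d) (pcompose (Psi_poly d) (monom 1 (n div d)))) =
      (\<Sum>k\<in>{1..n}. g k)"
    using sum_divisors_coprime[OF n, of "\<lambda>d k. smult (w d) (monom 1 k)"]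
    by (simp add: pcompose_Psi_poly smult_sum_right g_def)
  \<comment> \<open>The divisor sum has exponents 1 to \<open>n\<close>, whereas
    \<open>T_poly n\<close> has 0 to n - 1. Both end exponents have gcd \<open>n\<close> with
    \<open>n\<close>, hence weight \<open>w 1\<close> = 1, so \<open>1 - monom 1 n\<close> makes
    exactly this exchange.\<close>
  also have "\<dots> = (\<Sum>k<n. g k) + g n - g 0"
    using sum.atLeast_Suc_atMost[of 0 n g]
    by (simp add: lessThan_Suc_atMost[symmetric] atLeast0AtMost algebra_simps)
  finally have "1 - monom 1 n +
      (\<Sum>d | d dvd n. smult (w d) (pcompose (Psi_poly d) (monom 1 (n div d)))) = (\<Sum>k<n. g k)"
    using n w1 by (simp add: g_def one_pCons)
  moreover have "T_poly n = smult (real (totient n)) (\<Sum>k<n. g k)"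
    unfolding T_poly_def smult_sum_right
    by (intro sum.cong refl) (simp add: norm_ramanujan_sum[OF n] g_def w_def smult_monom)
  ultimately show ?thesis by (simp add: w_def)
qed

end
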